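(* Let $M$ be a differentiable manifold, $\nabla$ a linear connection on $M$ and $\gamma:J\to M$ a path ($J\subset\mathbb R$ an interval). One, and hence any, continuous basis along $\gamma$ in which the components of $\nabla$ vanish on $\gamma(J)$ is holonomic on $\gamma(J)$ if and only if $\nabla$ is torsion free on $\gamma(J)$.
   Context: In a local basis $\{E_i\}$ the components $\Gamma^i_{\ jk}$ of $\nabla$ are defined by $\nabla_XE_j=\Gamma^i_{\ jk}X^kE_i$ for $X=X^kE_k$ (summation convention). The torsion is $T^\nabla(X,Y)=\nabla_XY-\nabla_YX-[X,Y]$; $\nabla$ is torsion free on $\gamma(J)$ if $T^\nabla$ vanishes at every point of $\gamma(J)$. A continuous basis along $\gamma$ is a genuine, unglued basis of vector fields on a neighborhood of $\gamma(J)$ (as opposed to one pieced together discontinuously from local bases), taken to be $C^1$ so that the components and commutators make sense. It is holonomic on $\gamma(J)$ if $[E_i,E_j]|_{\gamma(s)}=0$ for all $i,j$ and all $s\in J$. The statement concerns the bases of the described kind, when such exist: each of them is holonomic on $\gamma(J)$ exactly when $\nabla$ is torsion free on $\gamma(J)$. *)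

theory Defs
  imports "HOL-Analysis.Analysis"
begin

text \<open>
  \<open>Ck_on k S f\<close>: the map \<open>f\<close> is of class \<open>C\<^sup>k\<close> on the open set \<open>S\<close>. In finite dimension it is
  enough to iterate directional derivatives. Smooth means \<open>Ck_on k S f\<close> for every \<open>k\<close>.
\<close>

primrec Ck_on ::
    "nat \<Rightarrow> 'a::real_normed_vector set \<Rightarrow> ('a \<Rightarrow> 'b::real_normed_vector) \<Rightarrow> bool" where
  "Ck_on 0 S f \<longleftrightarrow> continuous_on S f"
| "Ck_on (Suc k) S f \<longleftrightarrow>
     (\<forall>x\<in>S. f differentiable (at x)) \<and>
     (\<forall>v. Ck_on k S (\<lambda>x. frechet_derivative f (at x) v))"

type_synonym ('m, 'n) chart = "'m set \<times> ('m \<Rightarrow> real^'n)"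

abbreviation dom_of :: "('m, 'n) chart \<Rightarrow> 'm set" where
  "dom_of c \<equiv> fst c"

abbreviation coord :: "('m, 'n) chart \<Rightarrow> 'm \<Rightarrow> real^'n" where
  "coord c \<equiv> snd c"

definition chart_inv :: "('m, 'n) chart \<Rightarrow> real^'n \<Rightarrow> 'm" where
  "chart_inv c = inv_into (dom_of c) (coord c)"

definition transition :: "('m, 'n) chart \<Rightarrow> ('m, 'n) chart \<Rightarrow> real^'n \<Rightarrow> real^'n" where
  "transition c c' = coord c' \<circ> chart_inv c"

text \<open>
  The atlas is not required to be maximal: the notions below give the same result for any two
  atlases that define the same differentiable structure. Nor is second countability required,
  so both usual conventions about it are covered.
\<close>

locale smooth_manifold =
  fixes M :: "'m topology" and A :: "('m, 'n::finite) chart set"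
  assumes Hausdorff: "Hausdorff_space M"
    and dom_open: "c \<in> A \<Longrightarrow> openin M (dom_of c)"
    and dom_cover: "(\<Union>c\<in>A. dom_of c) = topspace M"
    and image_open: "c \<in> A \<Longrightarrow> open (coord c ` dom_of c)"
    and chart_homeomorphic: "c \<in> A \<Longrightarrow>
      homeomorphic_map (subtopology M (dom_of c)) (top_of_set (coord c ` dom_of c)) (coord c)"
    and transition_smooth: "c \<in> A \<Longrightarrow> c' \<in> A \<Longrightarrow>
      Ck_on k (coord c ` (dom_of c \<inter> dom_of c')) (transition c c')"

text \<open>
  A tangent vector at \<open>p\<close> is the family of its component vectors in the charts around \<open>p\<close>, subject
  to the contravariant transformation law. It is set to zero at all other pairs of a set and a
  map, so that two tangent vectors are equal iff they agree in the charts around \<open>p\<close>; the vector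
  space operations are pointwise.
\<close>

type_synonym ('m, 'n) tangent = "('m, 'n) chart \<Rightarrow> real^'n"

definition charts_at :: "('m, 'n) chart set \<Rightarrow> 'm \<Rightarrow> ('m, 'n) chart set" where
  "charts_at A p = {c \<in> A. p \<in> dom_of c}"

definition tangent_space ::
    "('m, 'n::finite) chart set \<Rightarrow> 'm \<Rightarrow> ('m, 'n) tangent set" where
  "tangent_space A p =
     {v. (\<forall>c\<in>charts_at A p. \<forall>c'\<in>charts_at A p.
            v c' = frechet_derivative (transition c c') (at (coord c p)) (v c)) \<and>
         (\<forall>c. c \<notin> charts_at A p \<longrightarrow> v c = 0)}"

definition Ck_function ::
    "('m, 'n::finite) chart set \<Rightarrow> nat \<Rightarrow> 'm set \<Rightarrow> ('m \<Rightarrow> real) \<Rightarrow> bool" where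
  "Ck_function A k U f \<longleftrightarrow>
     (\<forall>c\<in>A. Ck_on k (coord c ` (dom_of c \<inter> U)) (f \<circ> chart_inv c))"

text \<open>
  Fields and functions on an open set \<open>U\<close> are total functions whose values outside \<open>U\<close> are
  irrelevant.
\<close>

type_synonym ('m, 'n) field = "'m \<Rightarrow> ('m, 'n) tangent"

definition Ck_vector_field ::
    "('m, 'n::finite) chart set \<Rightarrow> nat \<Rightarrow> 'm set \<Rightarrow> ('m, 'n) field \<Rightarrow> bool" where
  "Ck_vector_field A k U X \<longleftrightarrow>
     (\<forall>p\<in>U. X p \<in> tangent_space A p) \<and>
     (\<forall>c\<in>A. Ck_on k (coord c ` (dom_of c \<inter> U)) (\<lambda>x. X (chart_inv c x) c))"

text \<open>
  The derivative of \<open>f\<close> at \<open>p\<close> in the direction of a tangent vector \<open>v\<close>; by the transformation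
  law of \<open>v\<close> the choice of the chart does not matter (see \<open>dir_deriv_chart\<close>).
\<close>

definition dir_deriv ::
    "('m, 'n::finite) chart set \<Rightarrow> ('m \<Rightarrow> real) \<Rightarrow> 'm \<Rightarrow> ('m, 'n) tangent \<Rightarrow> real" where
  "dir_deriv A f p v =
     (let c = (SOME c. c \<in> charts_at A p)
      in frechet_derivative (f \<circ> chart_inv c) (at (coord c p)) (v c))"

text \<open>
  The commutator in local coordinates,
  \<open>[X,Y]\<^sup>i = X\<^sup>k \<partial>\<^sub>k Y\<^sup>i - Y\<^sup>k \<partial>\<^sub>k X\<^sup>i\<close>, that is, \<open>[X,Y] f = X (Y f) - Y (X f)\<close> for the
  coordinate functions \<open>f\<close>, in each chart around \<open>p\<close>.
\<close>

definition commutator ::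
    "('m, 'n::finite) chart set \<Rightarrow> ('m, 'n) field \<Rightarrow> ('m, 'n) field \<Rightarrow> ('m, 'n) field" where
  "commutator A X Y = (\<lambda>p c.
     if c \<in> charts_at A p
     then frechet_derivative (\<lambda>x. Y (chart_inv c x) c) (at (coord c p)) (X p c)
        - frechet_derivative (\<lambda>x. X (chart_inv c x) c) (at (coord c p)) (Y p c)
     else 0)"

text \<open>
  A linear connection \<open>D X Y = \<nabla>\<^sub>X Y\<close>, as an operator on the \<open>C\<^sup>1\<close> vector fields defined on open
  subsets of \<open>M\<close>. The domain \<open>U\<close> of the fields is not an argument of \<open>D\<close>; axiom \<open>local\<close> says both
  that values outside \<open>U\<close> do not matter and that \<open>D\<close> is compatible with restriction to smaller
  open sets. The usual operator on globally defined smooth fields determines such an operator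
  uniquely.
\<close>

locale linear_connection = smooth_manifold M A
  for M :: "'m topology" and A :: "('m, 'n::finite) chart set" +
  fixes D :: "('m, 'n) field \<Rightarrow> ('m, 'n) field \<Rightarrow> ('m, 'n) field"
  assumes tangent:
      "\<lbrakk>openin M U; Ck_vector_field A 1 U X; Ck_vector_field A 1 U Y; p \<in> U\<rbrakk>
       \<Longrightarrow> D X Y p \<in> tangent_space A p"
    and smooth:
      "\<lbrakk>openin M U; \<And>k. Ck_vector_field A k U X; \<And>k. Ck_vector_field A k U Y\<rbrakk>
       \<Longrightarrow> Ck_vector_field A k U (D X Y)"
    and local:
      "\<lbrakk>openin M U; Ck_vector_field A 1 U X; Ck_vector_field A 1 U Y;
        \<And>q. q \<in> U \<Longrightarrow> X' q = X q; \<And>q. q \<in> U \<Longrightarrow> Y' q = Y q; p \<in> U\<rbrakk>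
       \<Longrightarrow> D X' Y' p = D X Y p"
    and add_left:
      "\<lbrakk>openin M U; Ck_vector_field A 1 U X; Ck_vector_field A 1 U X';
        Ck_vector_field A 1 U Y; p \<in> U\<rbrakk>
       \<Longrightarrow> D (\<lambda>q c. X q c + X' q c) Y p = (\<lambda>c. D X Y p c + D X' Y p c)"
    and scale_left:
      "\<lbrakk>openin M U; Ck_function A 1 U f; Ck_vector_field A 1 U X;
        Ck_vector_field A 1 U Y; p \<in> U\<rbrakk>
       \<Longrightarrow> D (\<lambda>q c. f q *\<^sub>R X q c) Y p = (\<lambda>c. f p *\<^sub>R D X Y p c)"
    and add_right:
      "\<lbrakk>openin M U; Ck_vector_field A 1 U X; Ck_vector_field A 1 U Y;
        Ck_vector_field A 1 U Y'; p \<in> U\<rbrakk>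
       \<Longrightarrow> D X (\<lambda>q c. Y q c + Y' q c) p = (\<lambda>c. D X Y p c + D X Y' p c)"
    and Leibniz:
      "\<lbrakk>openin M U; Ck_function A 1 U f; Ck_vector_field A 1 U X;
        Ck_vector_field A 1 U Y; p \<in> U\<rbrakk>
       \<Longrightarrow> D X (\<lambda>q c. f q *\<^sub>R Y q c) p =
           (\<lambda>c. f p *\<^sub>R D X Y p c + dir_deriv A f p (X p) *\<^sub>R Y p c)"

definition torsion ::
    "('m, 'n::finite) chart set \<Rightarrow> (('m, 'n) field \<Rightarrow> ('m, 'n) field \<Rightarrow> ('m, 'n) field)
     \<Rightarrow> ('m, 'n) field \<Rightarrow> ('m, 'n) field \<Rightarrow> ('m, 'n) field" where
  "torsion A D X Y = (\<lambda>p c. D X Y p c - D Y X p c - commutator A X Y p c)"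

definition torsion_free_on ::
    "'m topology \<Rightarrow> ('m, 'n::finite) chart set
     \<Rightarrow> (('m, 'n) field \<Rightarrow> ('m, 'n) field \<Rightarrow> ('m, 'n) field) \<Rightarrow> 'm set \<Rightarrow> bool" where
  "torsion_free_on M A D S \<longleftrightarrow>
     (\<forall>p\<in>S. \<forall>U X Y. openin M U \<and> p \<in> U \<and>
        Ck_vector_field A 1 U X \<and> Ck_vector_field A 1 U Y
        \<longrightarrow> torsion A D X Y p = (\<lambda>c. 0))"

definition tangent_basis ::
    "('m, 'n::finite) chart set \<Rightarrow> 'm \<Rightarrow> ('n \<Rightarrow> ('m, 'n) tangent) \<Rightarrow> bool" where
  "tangent_basis A p e \<longleftrightarrow>
     (\<forall>i. e i \<in> tangent_space A p) \<and>
     (\<forall>a. (\<lambda>c. \<Sum>i\<in>UNIV. a i *\<^sub>R e i c) = (\<lambda>c. 0) \<longrightarrow> (\<forall>i. a i = 0)) \<and>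
     (\<forall>v\<in>tangent_space A p. \<exists>a. v = (\<lambda>c. \<Sum>i\<in>UNIV. a i *\<^sub>R e i c))"

definition basis_along ::
    "'m topology \<Rightarrow> ('m, 'n::finite) chart set \<Rightarrow> (real \<Rightarrow> 'm) \<Rightarrow> real set
     \<Rightarrow> 'm set \<Rightarrow> ('n \<Rightarrow> ('m, 'n) field) \<Rightarrow> bool" where
  "basis_along M A \<gamma> J U E \<longleftrightarrow>
     openin M U \<and> \<gamma> ` J \<subseteq> U \<and> (\<forall>i. Ck_vector_field A 1 U (E i)) \<and>
     (\<forall>p\<in>U. tangent_basis A p (\<lambda>i. E i p))"

text \<open>
  \<open>\<Gamma> i j k\<close> is the component \<open>\<Gamma>\<^sup>i\<^sub>j\<^sub>k\<close>: \<open>\<nabla>\<^sub>X E\<^sub>j = \<Gamma>\<^sup>i\<^sub>j\<^sub>k X\<^sup>k E\<^sub>i\<close> for \<open>X = X\<^sup>k E\<^sub>k\<close>. In a basis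
  on \<open>U\<close> the components exist and are unique on \<open>U\<close>.
\<close>

definition connection_components ::
    "('m, 'n::finite) chart set \<Rightarrow> (('m, 'n) field \<Rightarrow> ('m, 'n) field \<Rightarrow> ('m, 'n) field)
     \<Rightarrow> 'm set \<Rightarrow> ('n \<Rightarrow> ('m, 'n) field) \<Rightarrow> ('n \<Rightarrow> 'n \<Rightarrow> 'n \<Rightarrow> 'm \<Rightarrow> real) \<Rightarrow> bool" where
  "connection_components A D U E \<Gamma> \<longleftrightarrow>
     (\<forall>X \<xi>. Ck_vector_field A 1 U X \<and>
            (\<forall>p\<in>U. X p = (\<lambda>c. \<Sum>k\<in>UNIV. \<xi> k p *\<^sub>R E k p c))
        \<longrightarrow> (\<forall>j. \<forall>p\<in>U. D X (E j) p =
               (\<lambda>c. \<Sum>i\<in>UNIV. (\<Sum>k\<in>UNIV. \<Gamma> i j k p * \<xi> k p) *\<^sub>R E i p c)))"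

definition components_vanish_on ::
    "('m, 'n::finite) chart set \<Rightarrow> (('m, 'n) field \<Rightarrow> ('m, 'n) field \<Rightarrow> ('m, 'n) field)
     \<Rightarrow> 'm set \<Rightarrow> ('n \<Rightarrow> ('m, 'n) field) \<Rightarrow> 'm set \<Rightarrow> bool" where
  "components_vanish_on A D U E S \<longleftrightarrow>
     (\<exists>\<Gamma>. connection_components A D U E \<Gamma> \<and> (\<forall>i j k. \<forall>p\<in>S. \<Gamma> i j k p = 0))"

definition holonomic_on ::
    "('m, 'n::finite) chart set \<Rightarrow> ('n \<Rightarrow> ('m, 'n) field) \<Rightarrow> 'm set \<Rightarrow> bool" where
  "holonomic_on A E S \<longleftrightarrow>
     (\<forall>p\<in>S. \<forall>i j. commutator A (E i) (E j) p = (\<lambda>c. 0))"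


context smooth_manifold
begin

lemma chart_inv_coord: "c \<in> A \<Longrightarrow> p \<in> dom_of c \<Longrightarrow> chart_inv c (coord c p) = p"
proof -
  assume c: "c \<in> A" and p: "p \<in> dom_of c"
  have "dom_of c \<subseteq> topspace M" using c dom_cover by blast
  then have "inj_on (coord c) (dom_of c)"
    using chart_homeomorphic[OF c] by (simp add: homeomorphic_eq_everything_map inf.absorb2)
  then show ?thesis using p by (simp add: chart_inv_def)
qed

lemma open_coord_image:
  assumes "c \<in> A" "openin M U"
  shows "open (coord c ` (dom_of c \<inter> U))"
proof -
  have "openin (subtopology M (dom_of c)) (dom_of c \<inter> U)"
    using assms(2) by (auto simp: openin_subtopology)
  then have "openin (top_of_set (coord c ` dom_of c)) (coord c ` (dom_of c \<inter> U))"
    using chart_homeomorphic[OF assms(1)] homeomorphic_imp_open_map open_map_def by blast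
  then show ?thesis
    using image_open[OF assms(1)] openin_open_trans by blast
qed

lemma dir_deriv_chart:
  assumes U: "openin M U" "p \<in> U" and f: "Ck_function A 1 U f"
    and v: "v \<in> tangent_space A p" and c: "c \<in> charts_at A p"
  shows "dir_deriv A f p v = frechet_derivative (f \<circ> chart_inv c) (at (coord c p)) (v c)"
proof -
  define b where "b = (SOME b. b \<in> charts_at A p)"
  have b: "b \<in> charts_at A p" unfolding b_def using c by (rule someI)
  have bA: "b \<in> A" "p \<in> dom_of b" and cA: "c \<in> A" "p \<in> dom_of c"
    using b c by (auto simp: charts_at_def)
  let ?T = "transition b c" and ?x = "coord b p"
  let ?W = "coord b ` (dom_of b \<inter> (U \<inter> dom_of c))"
  have Tx: "?T ?x = coord c p"
    using chart_inv_coord[OF bA] by (simp add: transition_def)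
  have "Ck_on 1 (coord b ` (dom_of b \<inter> dom_of c)) ?T"
    using transition_smooth[OF bA(1) cA(1)] .
  then have dT: "(?T has_derivative frechet_derivative ?T (at ?x)) (at ?x)"
    using bA cA by (simp add: frechet_derivative_works)
  have "Ck_on 1 (coord c ` (dom_of c \<inter> U)) (f \<circ> chart_inv c)"
    using f cA unfolding Ck_function_def by blast
  then have df: "((f \<circ> chart_inv c) has_derivative
      frechet_derivative (f \<circ> chart_inv c) (at (coord c p))) (at (?T ?x))"
    using cA U(2) by (simp add: frechet_derivative_works Tx)
  have "((f \<circ> chart_inv c) \<circ> ?T has_derivative
      frechet_derivative (f \<circ> chart_inv c) (at (coord c p)) \<circ> frechet_derivative ?T (at ?x)) (at ?x)"
    by (rule diff_chain_at[OF dT df])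
  moreover have "open ?W"
    using open_coord_image[OF bA(1)] U(1) dom_open[OF cA(1)] by blast
  moreover have "?x \<in> ?W" using bA cA U by blast
  moreover have "((f \<circ> chart_inv c) \<circ> ?T) y = (f \<circ> chart_inv b) y" if "y \<in> ?W" for y
    using that chart_inv_coord[OF bA(1)] chart_inv_coord[OF cA(1)] by (auto simp: transition_def)
  ultimately have "(f \<circ> chart_inv b has_derivative
      frechet_derivative (f \<circ> chart_inv c) (at (coord c p)) \<circ> frechet_derivative ?T (at ?x)) (at ?x)"
    by (rule has_derivative_transform_within_open)
  then have "frechet_derivative (f \<circ> chart_inv b) (at ?x) =
      frechet_derivative (f \<circ> chart_inv c) (at (coord c p)) \<circ> frechet_derivative ?T (at ?x)"
    using frechet_derivative_at by metis
  moreover have "v c = frechet_derivative ?T (at ?x) (v b)"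
    using v b c unfolding tangent_space_def by blast
  ultimately show ?thesis
    unfolding dir_deriv_def b_def[symmetric] Let_def by simp
qed

end

end

theory Submission
  imports Defs
begin

text \<open>
  The torsion is a tensor: \<open>T(f X, Y) = f T(X, Y)\<close> for a function \<open>f\<close> of class \<open>C\<^sup>1\<close>, because the
  term \<open>(Y f) X\<close> that the Leibniz rule produces in \<open>\<nabla>\<^sub>Y (f X)\<close> cancels the one produced in
  \<open>[f X, Y]\<close> (\<open>torsion_scale_left\<close>). As \<open>T\<close> is also additive and antisymmetric, its value at \<open>p\<close> is
  determined by the values \<open>T(E\<^sub>i, E\<^sub>j)(p)\<close> on a single basis (\<open>torsion_determined_by_basis\<close>). If the
  components of \<open>\<nabla>\<close> in the basis vanish at \<open>p\<close>, then \<open>\<nabla>\<^sub>E\<^sub>i E\<^sub>j\<close> is zero at \<open>p\<close>, and so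
  \<open>T(E\<^sub>i, E\<^sub>j)(p) = - [E\<^sub>i, E\<^sub>j](p)\<close> (\<open>torsion_eq_neg_commutator\<close>). Hence all commutators of the basis
  vanish at \<open>p\<close> iff the torsion does. Torsion freeness does not mention the basis, so being
  holonomic is the same for all bases of this kind.

  The analytic ingredient is that the coefficients \<open>\<xi>\<^sup>k\<close> of a \<open>C\<^sup>1\<close> field \<open>X = \<xi>\<^sup>k E\<^sub>k\<close> are themselves
  \<open>C\<^sup>1\<close>; otherwise the Leibniz rule could not be applied to them. This is Cramer's rule in
  each chart (\<open>C1_coefficients_in_frame\<close>).
\<close>

section \<open>Functions of class \<open>C\<^sup>1\<close>\<close>

lemma C1_onI:
  assumes "\<And>x. x \<in> S \<Longrightarrow> (f has_derivative f' x) (at x)"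
    and "\<And>v. continuous_on S (\<lambda>x. f' x v)"
  shows "Ck_on 1 S f"
proof -
  have "frechet_derivative f (at x) = f' x" if "x \<in> S" for x
    using frechet_derivative_at[OF assms(1)[OF that]] by simp
  then have "continuous_on S (\<lambda>x. frechet_derivative f (at x) v)" for v
    using assms(2)[of v] by (simp cong: continuous_on_cong)
  then show ?thesis
    using assms(1) by (auto simp: differentiable_def)
qed

lemma C1_on_has_derivative:
  "Ck_on 1 S f \<Longrightarrow> x \<in> S \<Longrightarrow> (f has_derivative frechet_derivative f (at x)) (at x)"
  by (simp add: frechet_derivative_works)

lemma C1_on_continuous_derivative:
  "Ck_on 1 S f \<Longrightarrow> continuous_on S (\<lambda>x. frechet_derivative f (at x) v)"
  by simp

lemma C1_on_imp_continuous_on: "Ck_on 1 S f \<Longrightarrow> continuous_on S f"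
  by (simp add: continuous_at_imp_continuous_on differentiable_imp_continuous_within)

lemma Ck_on_subset: "Ck_on k S f \<Longrightarrow> T \<subseteq> S \<Longrightarrow> Ck_on k T f"
  by (induction k arbitrary: f) (auto intro: continuous_on_subset)

lemma C1_on_cong_open:
  assumes "open S" "\<And>x. x \<in> S \<Longrightarrow> f x = g x" "Ck_on 1 S f"
  shows "Ck_on 1 S g"
proof (rule C1_onI)
  show "(g has_derivative frechet_derivative f (at x)) (at x)" if "x \<in> S" for x
    using has_derivative_transform_within_open[OF C1_on_has_derivative[OF assms(3) that]
        assms(1) that assms(2)] .
qed (rule C1_on_continuous_derivative[OF assms(3)])

lemma C1_on_const: "Ck_on 1 S (\<lambda>x. b)"
  by (rule C1_onI[where f' = "\<lambda>x v. 0"]) auto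

lemma C1_on_add:
  assumes "Ck_on 1 S f" "Ck_on 1 S g"
  shows "Ck_on 1 S (\<lambda>x. f x + g x)"
  by (rule C1_onI[OF has_derivative_add[OF C1_on_has_derivative[OF assms(1)]
        C1_on_has_derivative[OF assms(2)]]])
    (auto intro: continuous_on_add C1_on_continuous_derivative[OF assms(1)]
       C1_on_continuous_derivative[OF assms(2)])

lemma C1_on_scaleR:
  fixes f :: "'a::real_normed_vector \<Rightarrow> real" and g :: "'a \<Rightarrow> 'b::real_normed_vector"
  assumes "Ck_on 1 S f" "Ck_on 1 S g"
  shows "Ck_on 1 S (\<lambda>x. f x *\<^sub>R g x)"
  by (rule C1_onI[OF has_derivative_scaleR[OF C1_on_has_derivative[OF assms(1)]
        C1_on_has_derivative[OF assms(2)]]])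
    (auto intro!: continuous_on_add continuous_on_scaleR C1_on_continuous_derivative[OF assms(1)]
       C1_on_continuous_derivative[OF assms(2)] C1_on_imp_continuous_on[OF assms(1)]
       C1_on_imp_continuous_on[OF assms(2)])

lemma C1_on_sum:
  assumes "\<And>i. i \<in> I \<Longrightarrow> Ck_on 1 S (f i)"
  shows "Ck_on 1 S (\<lambda>x. \<Sum>i\<in>I. f i x)"
  using assms
proof (induction I rule: infinite_finite_induct)
  case (insert i I)
  then have "Ck_on 1 S (\<lambda>x. f i x + (\<Sum>i\<in>I. f i x))"
    by (intro C1_on_add) auto
  then show ?case using insert by (simp del: Ck_on.simps One_nat_def)
qed (simp_all only: sum.infinite sum.empty C1_on_const not_False_eq_True)

lemma C1_on_prod:
  fixes f :: "'i \<Rightarrow> 'a::real_normed_vector \<Rightarrow> real"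
  assumes "\<And>i. i \<in> I \<Longrightarrow> Ck_on 1 S (f i)"
  shows "Ck_on 1 S (\<lambda>x. \<Prod>i\<in>I. f i x)"
  using assms
proof (induction I rule: infinite_finite_induct)
  case (insert i I)
  then have "Ck_on 1 S (\<lambda>x. f i x *\<^sub>R (\<Prod>i\<in>I. f i x))"
    by (intro C1_on_scaleR) auto
  then show ?case using insert by (simp del: Ck_on.simps One_nat_def)
qed (simp_all only: prod.infinite prod.empty C1_on_const not_False_eq_True)

lemma C1_on_divide:
  fixes f g :: "'a::real_normed_vector \<Rightarrow> real"
  assumes f: "Ck_on 1 S f" and g: "Ck_on 1 S g" and nz: "\<And>x. x \<in> S \<Longrightarrow> g x \<noteq> 0"
  shows "Ck_on 1 S (\<lambda>x. f x / g x)"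
proof -
  have "Ck_on 1 S (\<lambda>x. inverse (g x))"
  proof (rule C1_onI)
    show "((\<lambda>x. inverse (g x)) has_derivative
        (\<lambda>h. - (inverse (g x) * frechet_derivative g (at x) h * inverse (g x)))) (at x)"
      if "x \<in> S" for x
      using Deriv.has_derivative_inverse[OF nz[OF that] C1_on_has_derivative[OF g that]] .
    show "continuous_on S
        (\<lambda>x. - (inverse (g x) * frechet_derivative g (at x) v * inverse (g x)))" for v
      using nz by (intro continuous_intros C1_on_continuous_derivative[OF g]
          C1_on_imp_continuous_on[OF g]) auto
  qed
  from C1_on_scaleR[OF f this] show ?thesis
    by (simp only: real_scaleR_def divide_inverse)
qed

lemma C1_on_nth:
  fixes f :: "'a::real_normed_vector \<Rightarrow> real^'n::finite"
  assumes "Ck_on 1 S f"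
  shows "Ck_on 1 S (\<lambda>x. f x $ i)"
proof (rule C1_onI)
  show "((\<lambda>x. f x $ i) has_derivative (\<lambda>v. frechet_derivative f (at x) v $ i)) (at x)"
    if "x \<in> S" for x
    using bounded_linear.has_derivative[OF bounded_linear_vec_nth
        C1_on_has_derivative[OF assms that]] .
qed (intro continuous_intros C1_on_continuous_derivative[OF assms])

lemma C1_on_det:
  fixes B :: "'a::real_normed_vector \<Rightarrow> real^'n^'n::finite"
  assumes "\<And>i j. Ck_on 1 S (\<lambda>x. B x $ i $ j)"
  shows "Ck_on 1 S (\<lambda>x. det (B x))"
proof -
  have "Ck_on 1 S (\<lambda>x. \<Sum>\<sigma>\<in>{\<sigma>. \<sigma> permutes (UNIV :: 'n set)}.
      of_int (sign \<sigma>) *\<^sub>R (\<Prod>i\<in>UNIV. B x $ i $ \<sigma> i))"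
    by (intro C1_on_sum C1_on_scaleR C1_on_const C1_on_prod assms)
  then show ?thesis by (simp only: det_def real_scaleR_def)
qed


section \<open>Vector fields in charts\<close>

lemma Ck_vector_field_subset:
  "Ck_vector_field A k U X \<Longrightarrow> V \<subseteq> U \<Longrightarrow> Ck_vector_field A k V X"
  unfolding Ck_vector_field_def by (meson Ck_on_subset Int_mono image_mono order_refl subsetD)

lemma tangent_space_outside: "v \<in> tangent_space A p \<Longrightarrow> c \<notin> charts_at A p \<Longrightarrow> v c = 0"
  unfolding tangent_space_def by blast

lemma field_has_derivative:
  assumes "Ck_vector_field A 1 U X" "p \<in> U" "c \<in> charts_at A p"
  shows "((\<lambda>x. X (chart_inv c x) c) has_derivative
    frechet_derivative (\<lambda>x. X (chart_inv c x) c) (at (coord c p))) (at (coord c p))"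
proof (rule C1_on_has_derivative)
  show "Ck_on 1 (coord c ` (dom_of c \<inter> U)) (\<lambda>x. X (chart_inv c x) c)"
    using assms unfolding Ck_vector_field_def charts_at_def by blast
qed (use assms in \<open>auto simp: charts_at_def\<close>)

lemma function_has_derivative:
  assumes "Ck_function A 1 U f" "p \<in> U" "c \<in> charts_at A p"
  shows "((\<lambda>x. f (chart_inv c x)) has_derivative
    frechet_derivative (f \<circ> chart_inv c) (at (coord c p))) (at (coord c p))"
proof -
  have "Ck_on 1 (coord c ` (dom_of c \<inter> U)) (f \<circ> chart_inv c)"
    using assms unfolding Ck_function_def charts_at_def by blast
  from C1_on_has_derivative[OF this] show ?thesis
    using assms by (auto simp: charts_at_def o_def)
qed

lemma Ck_function_const: "Ck_function A 1 U (\<lambda>q. a)"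
  unfolding Ck_function_def o_def by (blast intro: C1_on_const)

context smooth_manifold
begin

lemma chart_inv_coord_at: "c \<in> charts_at A p \<Longrightarrow> chart_inv c (coord c p) = p"
  by (simp add: charts_at_def chart_inv_coord)

lemma linear_transition_derivative:
  assumes "c \<in> charts_at A p" "c' \<in> charts_at A p"
  shows "linear (frechet_derivative (transition c c') (at (coord c p)))"
proof -
  have "Ck_on 1 (coord c ` (dom_of c \<inter> dom_of c')) (transition c c')"
    using assms transition_smooth by (simp add: charts_at_def del: Ck_on.simps)
  then have "(transition c c' has_derivative
      frechet_derivative (transition c c') (at (coord c p))) (at (coord c p))"
    using assms
    by (auto intro!: C1_on_has_derivative simp: charts_at_def simp del: Ck_on.simps One_nat_def)
  then show ?thesis by (rule has_derivative_linear)
qed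

lemma tangent_space_lincomb:
  assumes "\<And>k. k \<in> K \<Longrightarrow> e k \<in> tangent_space A p"
  shows "(\<lambda>c. \<Sum>k\<in>K. a k *\<^sub>R e k c) \<in> tangent_space A p"
proof -
  have "(\<Sum>k\<in>K. a k *\<^sub>R e k c') =
      frechet_derivative (transition c c') (at (coord c p)) (\<Sum>k\<in>K. a k *\<^sub>R e k c)"
    if c: "c \<in> charts_at A p" "c' \<in> charts_at A p" for c c'
  proof -
    note lin = linear_transition_derivative[OF c]
    have "e k c' = frechet_derivative (transition c c') (at (coord c p)) (e k c)" if "k \<in> K" for k
      using assms[OF that] c unfolding tangent_space_def by blast
    then show ?thesis
      by (simp add: linear_sum[OF lin] linear_scale[OF lin])
  qed
  moreover have "(\<Sum>k\<in>K. a k *\<^sub>R e k c) = 0" if "c \<notin> charts_at A p" for c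
    using tangent_space_outside[OF assms that] by simp
  ultimately show ?thesis unfolding tangent_space_def by blast
qed

lemma C1_vector_field_lincomb:
  assumes f: "\<And>k. k \<in> K \<Longrightarrow> Ck_function A 1 U (f k)"
    and X: "\<And>k. k \<in> K \<Longrightarrow> Ck_vector_field A 1 U (X k)"
  shows "Ck_vector_field A 1 U (\<lambda>q c. \<Sum>k\<in>K. f k q *\<^sub>R X k q c)"
  unfolding Ck_vector_field_def
proof (intro conjI ballI)
  show "(\<lambda>c. \<Sum>k\<in>K. f k q *\<^sub>R X k q c) \<in> tangent_space A q" if "q \<in> U" for q
    using that X by (intro tangent_space_lincomb) (auto simp: Ck_vector_field_def)
  show "Ck_on 1 (coord c ` (dom_of c \<inter> U))
      (\<lambda>x. \<Sum>k\<in>K. f k (chart_inv c x) *\<^sub>R X k (chart_inv c x) c)" if "c \<in> A" for c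
    using that f X unfolding Ck_function_def Ck_vector_field_def o_def
    by (intro C1_on_sum C1_on_scaleR) blast+
qed

lemma C1_vector_field_scale:
  assumes "Ck_function A 1 U f" "Ck_vector_field A 1 U X"
  shows "Ck_vector_field A 1 U (\<lambda>q c. f q *\<^sub>R X q c)"
  using C1_vector_field_lincomb[of "{()}" U "\<lambda>_. f" "\<lambda>_. X"] assms by simp

text \<open>
  A linear relation among the component vectors in one chart is carried to every other chart by the
  transformation law, so it is a relation among the tangent vectors. Thus the components of a
  basis form an invertible matrix in each chart.
\<close>

lemma tangent_basis_det_nonzero:
  assumes e: "tangent_basis A p e" and c: "c \<in> charts_at A p"
  shows "det (\<chi> i k. e k c $ i) \<noteq> 0"
proof -
  let ?B = "\<chi> i k. e k c $ i"
  have mult: "?B *v a = (\<Sum>k\<in>UNIV. a $ k *\<^sub>R e k c)" for a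
    by (simp add: vec_eq_iff matrix_vector_mult_def mult.commute)
  have "a = 0" if a: "?B *v a = 0" for a
  proof -
    let ?w = "\<lambda>c. \<Sum>k\<in>UNIV. a $ k *\<^sub>R e k c"
    have w: "?w \<in> tangent_space A p"
      using e by (intro tangent_space_lincomb) (auto simp: tangent_basis_def)
    have "?w c' = 0" for c'
    proof (cases "c' \<in> charts_at A p")
      case True
      have "?w c' = frechet_derivative (transition c c') (at (coord c p)) (?w c)"
        using w c True unfolding tangent_space_def by blast
      also have "\<dots> = 0"
        using a linear_0[OF linear_transition_derivative[OF c True]] by (simp add: mult)
      finally show ?thesis .
    qed (rule tangent_space_outside[OF w])
    then have "?w = (\<lambda>c. 0)" by blast
    then have "\<forall>k. a $ k = 0" using e unfolding tangent_basis_def by blast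
    then show ?thesis by (simp add: vec_eq_iff)
  qed
  then have "invertible ?B"
    by (meson invertible_left_inverse matrix_left_invertible_ker)
  then show ?thesis by (simp add: invertible_det_nz)
qed

text \<open>
  By Cramer's rule the coefficients are quotients of determinants of \<open>C\<^sup>1\<close> functions in each
  chart. They are chosen pointwise on the manifold, so the same functions serve all charts.
\<close>

lemma C1_coefficients_in_frame:
  assumes V: "openin M V"
    and E: "\<And>i. Ck_vector_field A 1 V (E i)" "\<And>q. q \<in> V \<Longrightarrow> tangent_basis A q (\<lambda>i. E i q)"
    and X: "Ck_vector_field A 1 V X"
  obtains \<xi> where "\<And>k. Ck_function A 1 V (\<xi> k)"
    and "\<And>q. q \<in> V \<Longrightarrow> X q = (\<lambda>c. \<Sum>k\<in>UNIV. \<xi> k q *\<^sub>R E k q c)"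
proof -
  have "\<forall>q\<in>V. \<exists>a. X q = (\<lambda>c. \<Sum>k\<in>UNIV. a k *\<^sub>R E k q c)"
    using E(2) X unfolding tangent_basis_def Ck_vector_field_def by blast
  then obtain a where a: "\<And>q. q \<in> V \<Longrightarrow> X q = (\<lambda>c. \<Sum>k\<in>UNIV. a q k *\<^sub>R E k q c)"
    by metis
  have "Ck_function A 1 V (\<lambda>q. a q k)" for k
    unfolding Ck_function_def
  proof
    fix c assume c: "c \<in> A"
    let ?S = "coord c ` (dom_of c \<inter> V)"
    define B where "B = (\<lambda>x. \<chi> i j. E j (chart_inv c x) c $ i)"
    define N where
      "N = (\<lambda>x. \<chi> i j. if j = k then X (chart_inv c x) c $ i else B x $ i $ j)"
    have B: "Ck_on 1 ?S (\<lambda>x. B x $ i $ j)" for i j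
    proof -
      have "Ck_on 1 ?S (\<lambda>x. E j (chart_inv c x) c $ i)"
        using E(1)[of j] c unfolding Ck_vector_field_def by (intro C1_on_nth) blast
      then show ?thesis unfolding B_def by (simp del: Ck_on.simps One_nat_def)
    qed
    have N: "Ck_on 1 ?S (\<lambda>x. N x $ i $ j)" for i j
    proof (cases "j = k")
      case True
      have "Ck_on 1 ?S (\<lambda>x. X (chart_inv c x) c $ i)"
        using X c unfolding Ck_vector_field_def by (intro C1_on_nth) blast
      then show ?thesis using True unfolding N_def by (simp del: Ck_on.simps One_nat_def)
    next
      case False
      then show ?thesis using B[of i j] unfolding N_def by (simp del: Ck_on.simps One_nat_def)
    qed
    have cramer_at: "det (B x) \<noteq> 0 \<and> det (N x) / det (B x) = a (chart_inv c x) k"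
      if x: "x \<in> ?S" for x
    proof -
      obtain q where q: "q \<in> dom_of c" "q \<in> V" "x = coord c q" using x by blast
      have cq: "c \<in> charts_at A q" using c q by (simp add: charts_at_def)
      have inv: "chart_inv c x = q" using chart_inv_coord_at[OF cq] q by simp
      have nz: "det (B x) \<noteq> 0"
        using tangent_basis_det_nonzero[OF E(2)[OF q(2)] cq] by (simp add: B_def inv)
      have "X q c = (\<Sum>k\<in>UNIV. a q k *\<^sub>R E k q c)"
        using fun_cong[OF a[OF q(2)]] by simp
      then have "B x *v (\<chi> k. a q k) = X q c"
        by (simp add: B_def inv vec_eq_iff matrix_vector_mult_def mult.commute)
      from this[unfolded cramer[OF nz]] show ?thesis
        using nz by (simp add: vec_eq_iff N_def inv cong: if_cong)
    qed
    show "Ck_on 1 ?S ((\<lambda>q. a q k) \<circ> chart_inv c)"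
    proof (rule C1_on_cong_open[OF open_coord_image[OF c V]])
      show "det (N x) / det (B x) = ((\<lambda>q. a q k) \<circ> chart_inv c) x" if "x \<in> ?S" for x
        using cramer_at[OF that] by simp
      show "Ck_on 1 ?S (\<lambda>x. det (N x) / det (B x))"
        using cramer_at by (intro C1_on_divide C1_on_det B N) blast
    qed
  qed
  then show thesis using that[of "\<lambda>k q. a q k"] a by blast
qed


section \<open>The commutator\<close>

lemma commutator_outside: "c \<notin> charts_at A p \<Longrightarrow> commutator A X Y p c = 0"
  by (simp add: commutator_def)

lemma commutator_swap: "commutator A Y X p c = - commutator A X Y p c"
  by (simp add: commutator_def)

lemma frechet_derivative_field_cong:
  assumes U: "openin M U" "p \<in> U" and c: "c \<in> charts_at A p"
    and eq: "\<And>q. q \<in> U \<Longrightarrow> X' q = X q" and X: "Ck_vector_field A 1 U X"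
  shows "frechet_derivative (\<lambda>x. X' (chart_inv c x) c) (at (coord c p)) =
    frechet_derivative (\<lambda>x. X (chart_inv c x) c) (at (coord c p))"
proof -
  have cA: "c \<in> A" "p \<in> dom_of c" using c by (auto simp: charts_at_def)
  have "((\<lambda>x. X' (chart_inv c x) c) has_derivative
      frechet_derivative (\<lambda>x. X (chart_inv c x) c) (at (coord c p))) (at (coord c p))"
    by (rule has_derivative_transform_within_open[OF field_has_derivative[OF X U(2) c]
          open_coord_image[OF cA(1) U(1)]])
      (use cA U(2) in \<open>auto simp: eq chart_inv_coord[OF cA(1)]\<close>)
  from frechet_derivative_at[OF this] show ?thesis by simp
qed

lemma commutator_cong:
  assumes U: "openin M U" "p \<in> U"
    and X: "Ck_vector_field A 1 U X" "\<And>q. q \<in> U \<Longrightarrow> X' q = X q"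
    and Y: "Ck_vector_field A 1 U Y" "\<And>q. q \<in> U \<Longrightarrow> Y' q = Y q"
  shows "commutator A X' Y' p = commutator A X Y p"
  using frechet_derivative_field_cong[OF U _ X(2) X(1)]
    frechet_derivative_field_cong[OF U _ Y(2) Y(1)] X(2)[OF U(2)] Y(2)[OF U(2)]
  by (auto simp: commutator_def fun_eq_iff)

lemma commutator_add_left:
  assumes U: "p \<in> U" and X: "Ck_vector_field A 1 U X" and X': "Ck_vector_field A 1 U X'"
    and Y: "Ck_vector_field A 1 U Y"
  shows "commutator A (\<lambda>q c. X q c + X' q c) Y p c = commutator A X Y p c + commutator A X' Y p c"
proof (cases "c \<in> charts_at A p")
  case True
  note dX = field_has_derivative[OF X U True] and dX' = field_has_derivative[OF X' U True]
    and dY = field_has_derivative[OF Y U True]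
  show ?thesis
    using frechet_derivative_at[OF has_derivative_add[OF dX dX'], symmetric]
      linear_add[OF has_derivative_linear[OF dY]] True
    by (simp add: commutator_def)
qed (simp add: commutator_outside)

text \<open>
  The last term is the failure of the commutator to be a tensor.
\<close>

lemma commutator_scale_left:
  assumes U: "openin M U" "p \<in> U" and f: "Ck_function A 1 U f"
    and X: "Ck_vector_field A 1 U X" and Y: "Ck_vector_field A 1 U Y"
  shows "commutator A (\<lambda>q c. f q *\<^sub>R X q c) Y p c =
    f p *\<^sub>R commutator A X Y p c - dir_deriv A f p (Y p) *\<^sub>R X p c"
proof (cases "c \<in> charts_at A p")
  case True
  note df = function_has_derivative[OF f U(2) True]
    and dX = field_has_derivative[OF X U(2) True] and dY = field_has_derivative[OF Y U(2) True]
  have "Y p \<in> tangent_space A p" using Y U by (simp add: Ck_vector_field_def)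
  note dir = dir_deriv_chart[OF U f this True]
  show ?thesis
    using frechet_derivative_at[OF has_derivative_scaleR[OF df dX], symmetric]
      linear_scale[OF has_derivative_linear[OF dY]] True
    by (simp add: commutator_def dir chart_inv_coord_at algebra_simps)
next
  case False
  have "X p c = 0"
    using X U False by (auto simp: Ck_vector_field_def intro: tangent_space_outside)
  then show ?thesis using False by (simp add: commutator_outside)
qed

end


section \<open>The torsion is a tensor\<close>

context linear_connection
begin

lemma torsion_swap: "torsion A D Y X p c = - torsion A D X Y p c"
  by (simp add: torsion_def commutator_swap[of X Y])

lemma torsion_cong:
  assumes U: "openin M U" "p \<in> U"
    and X: "Ck_vector_field A 1 U X" "\<And>q. q \<in> U \<Longrightarrow> X' q = X q"
    and Y: "Ck_vector_field A 1 U Y" "\<And>q. q \<in> U \<Longrightarrow> Y' q = Y q"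
  shows "torsion A D X' Y' p = torsion A D X Y p"
  using commutator_cong[OF U X Y] local[OF U(1) X(1) Y(1) X(2) Y(2) U(2)]
    local[OF U(1) Y(1) X(1) Y(2) X(2) U(2)]
  by (simp add: torsion_def)

lemma torsion_add_left:
  assumes U: "openin M U" "p \<in> U" and X: "Ck_vector_field A 1 U X"
    and X': "Ck_vector_field A 1 U X'" and Y: "Ck_vector_field A 1 U Y"
  shows "torsion A D (\<lambda>q c. X q c + X' q c) Y p c = torsion A D X Y p c + torsion A D X' Y p c"
  by (simp add: torsion_def add_left[OF U(1) X X' Y U(2)] add_right[OF U(1) Y X X' U(2)]
      commutator_add_left[OF U(2) X X' Y])

text \<open>
  The derivative of \<open>f\<close> along \<open>Y\<close> enters once through the Leibniz rule for \<open>\<nabla>\<^sub>Y (f X)\<close> and once,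
  with the opposite sign, through the commutator.
\<close>

lemma torsion_scale_left:
  assumes U: "openin M U" "p \<in> U" and f: "Ck_function A 1 U f"
    and X: "Ck_vector_field A 1 U X" and Y: "Ck_vector_field A 1 U Y"
  shows "torsion A D (\<lambda>q c. f q *\<^sub>R X q c) Y p c = f p *\<^sub>R torsion A D X Y p c"
  by (simp add: torsion_def scale_left[OF U(1) f X Y U(2)] Leibniz[OF U(1) f Y X U(2)]
      commutator_scale_left[OF U f X Y] algebra_simps)

lemma torsion_lincomb_left:
  assumes U: "openin M U" "p \<in> U" and Y: "Ck_vector_field A 1 U Y" and K: "finite K"
    and f: "\<And>k. k \<in> K \<Longrightarrow> Ck_function A 1 U (f k)"
    and X: "\<And>k. k \<in> K \<Longrightarrow> Ck_vector_field A 1 U (X k)"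
  shows "torsion A D (\<lambda>q c. \<Sum>k\<in>K. f k q *\<^sub>R X k q c) Y p c =
    (\<Sum>k\<in>K. f k p *\<^sub>R torsion A D (X k) Y p c)"
  using K f X
proof (induction K)
  case empty
  \<comment> \<open>The zero field is \<open>0 Y\<close>, a multiple of a \<open>C\<^sup>1\<close> field.\<close>
  show ?case
    using torsion_scale_left[OF U Ck_function_const Y Y, of 0 c] by simp
next
  case (insert k K)
  have k: "Ck_vector_field A 1 U (\<lambda>q c. f k q *\<^sub>R X k q c)"
    using insert.prems by (intro C1_vector_field_scale) auto
  have K: "Ck_vector_field A 1 U (\<lambda>q c. \<Sum>k\<in>K. f k q *\<^sub>R X k q c)"
    using insert.prems by (intro C1_vector_field_lincomb) auto
  show ?case
    using torsion_add_left[OF U k K Y] torsion_scale_left[OF U _ _ Y, of "f k" "X k"] insert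
    by (simp del: One_nat_def)
qed

text \<open>
  By antisymmetry, expanding the left argument is enough: it is applied to both arguments
  in turn.
\<close>

lemma torsion_determined_by_basis:
  assumes U: "openin M U" "p \<in> U"
    and E: "\<And>i. Ck_vector_field A 1 U (E i)" "\<And>q. q \<in> U \<Longrightarrow> tangent_basis A q (\<lambda>i. E i q)"
    and zero: "\<And>i j. torsion A D (E i) (E j) p = (\<lambda>c. 0)"
    and X: "Ck_vector_field A 1 U X" and Y: "Ck_vector_field A 1 U Y"
  shows "torsion A D X Y p = (\<lambda>c. 0)"
proof -
  have expand: "torsion A D Z W p = (\<lambda>c. 0)"
    if Z: "Ck_vector_field A 1 U Z" and W: "Ck_vector_field A 1 U W"
      and EW: "\<And>k. torsion A D (E k) W p = (\<lambda>c. 0)" for Z W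
  proof -
    obtain \<zeta> where \<zeta>: "\<And>k. Ck_function A 1 U (\<zeta> k)"
      and Z_eq: "\<And>q. q \<in> U \<Longrightarrow> Z q = (\<lambda>c. \<Sum>k\<in>UNIV. \<zeta> k q *\<^sub>R E k q c)"
      using C1_coefficients_in_frame[OF U(1) E Z] by blast
    have "torsion A D Z W p = torsion A D (\<lambda>q c. \<Sum>k\<in>UNIV. \<zeta> k q *\<^sub>R E k q c) W p"
      by (rule torsion_cong[OF U C1_vector_field_lincomb[OF \<zeta> E(1)] Z_eq W refl])
    also have "\<dots> = (\<lambda>c. \<Sum>k\<in>UNIV. \<zeta> k p *\<^sub>R torsion A D (E k) W p c)"
      by (rule ext, rule torsion_lincomb_left[OF U W finite_class.finite_UNIV \<zeta> E(1)])
    also have "\<dots> = (\<lambda>c. 0)" by (simp add: EW)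
    finally show ?thesis .
  qed
  have "torsion A D (E k) Y p = (\<lambda>c. 0)" for k
    using expand[OF Y E(1) zero, of k] torsion_swap[of Y "E k" p] by (simp add: fun_eq_iff)
  then show ?thesis by (rule expand[OF X Y])
qed


section \<open>Bases in which the connection components vanish\<close>

lemma torsion_eq_neg_commutator:
  assumes E: "\<And>i. Ck_vector_field A 1 U (E i)" and S: "components_vanish_on A D U E S"
    and p: "p \<in> S" "p \<in> U"
  shows "torsion A D (E i) (E j) p c = - commutator A (E i) (E j) p c"
proof -
  obtain \<Gamma> where \<Gamma>: "connection_components A D U E \<Gamma>" and zero: "\<And>i j k. \<Gamma> i j k p = 0"
    using S p unfolding components_vanish_on_def by blast
  have "D (E k) (E l) p c = 0" for k l
  proof -
    \<comment> \<open>The components of \<open>\<nabla>\<close> are defined through an expansion of the left field, here \<open>E k\<close>.\<close>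
    define \<delta> where "\<delta> = (\<lambda>m (q::'m). if m = k then 1 else 0 :: real)"
    have "\<forall>q\<in>U. E k q = (\<lambda>c. \<Sum>m\<in>UNIV. \<delta> m q *\<^sub>R E m q c)"
      by (simp add: \<delta>_def if_distrib[where f = "\<lambda>r. r *\<^sub>R _"] cong: if_cong)
    then have "D (E k) (E l) p =
        (\<lambda>c. \<Sum>i\<in>UNIV. (\<Sum>m\<in>UNIV. \<Gamma> i l m p * \<delta> m p) *\<^sub>R E i p c)"
      using \<Gamma> E p(2) unfolding connection_components_def by blast
    then show ?thesis by (simp add: zero)
  qed
  then show ?thesis by (simp add: torsion_def)
qed

lemma holonomic_iff_torsion_free:
  assumes U: "openin M U" "S \<subseteq> U"
    and E: "\<And>i. Ck_vector_field A 1 U (E i)" "\<And>q. q \<in> U \<Longrightarrow> tangent_basis A q (\<lambda>i. E i q)"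
    and vanish: "components_vanish_on A D U E S"
  shows "holonomic_on A E S \<longleftrightarrow> torsion_free_on M A D S"
proof
  assume hol: "holonomic_on A E S"
  show "torsion_free_on M A D S"
    unfolding torsion_free_on_def
  proof (intro ballI allI impI, elim conjE)
    fix p W X Y
    assume p: "p \<in> S" and W: "openin M W" "p \<in> W"
      and X: "Ck_vector_field A 1 W X" and Y: "Ck_vector_field A 1 W Y"
    \<comment> \<open>\<open>X\<close> and \<open>Y\<close> are fields on a neighborhood \<open>W\<close> of \<open>p\<close> only, so they are expanded in the
      restriction of the basis to \<open>U \<inter> W\<close>.\<close>
    let ?V = "U \<inter> W"
    show "torsion A D X Y p = (\<lambda>c. 0)"
    proof (rule torsion_determined_by_basis[where U = ?V and E = E])
      show "openin M ?V" "p \<in> ?V" using U W p by auto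
      show "Ck_vector_field A 1 ?V (E i)" for i
        using E(1) by (rule Ck_vector_field_subset) simp
      show "Ck_vector_field A 1 ?V X" "Ck_vector_field A 1 ?V Y"
        using X Y by (auto intro: Ck_vector_field_subset simp del: One_nat_def)
      show "tangent_basis A q (\<lambda>i. E i q)" if "q \<in> ?V" for q using E(2) that by simp
      show "torsion A D (E i) (E j) p = (\<lambda>c. 0)" for i j
        using torsion_eq_neg_commutator[OF E(1) vanish p] p U hol
        by (auto simp: holonomic_on_def fun_eq_iff)
    qed
  qed
next
  assume tf: "torsion_free_on M A D S"
  have "commutator A (E i) (E j) p = (\<lambda>c. 0)" if p: "p \<in> S" for p i j
  proof -
    have pU: "p \<in> U" using p U by blast
    have "torsion A D (E i) (E j) p = (\<lambda>c. 0)"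
      using tf p pU U(1) E(1) unfolding torsion_free_on_def by blast
    then show ?thesis
      using torsion_eq_neg_commutator[OF E(1) vanish p pU, of i j] by (simp add: fun_eq_iff)
  qed
  then show "holonomic_on A E S" by (simp add: holonomic_on_def)
qed

end

theorem corollary12:
  fixes M :: "'m topology"
    and A :: "('m, 'n::finite) chart set"
    and D :: "('m, 'n) field \<Rightarrow> ('m, 'n) field \<Rightarrow> ('m, 'n) field"
    and \<gamma> :: "real \<Rightarrow> 'm"
    and J :: "real set"
  assumes "smooth_manifold M A"
    and "linear_connection M A D"
    and "is_interval J"
    and "continuous_map (top_of_set J) M \<gamma>"
  shows "(\<forall>U E. basis_along M A \<gamma> J U E \<and> components_vanish_on A D U E (\<gamma> ` J)
            \<longrightarrow> (holonomic_on A E (\<gamma> ` J) \<longleftrightarrow> torsion_free_on M A D (\<gamma> ` J)))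
       \<and> ((\<exists>U E. basis_along M A \<gamma> J U E \<and> components_vanish_on A D U E (\<gamma> ` J)
                \<and> holonomic_on A E (\<gamma> ` J))
            \<longrightarrow> (\<forall>U E. basis_along M A \<gamma> J U E \<and> components_vanish_on A D U E (\<gamma> ` J)
                \<longrightarrow> holonomic_on A E (\<gamma> ` J)))"
proof -
  interpret linear_connection M A D by (rule assms(2))
  have "holonomic_on A E (\<gamma> ` J) \<longleftrightarrow> torsion_free_on M A D (\<gamma> ` J)"
    if "basis_along M A \<gamma> J U E" "components_vanish_on A D U E (\<gamma> ` J)" for U E
    using that holonomic_iff_torsion_free[of U "\<gamma> ` J" E] unfolding basis_along_def by blast
  then show ?thesis by blast
qed

end
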